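(* Let $d, m \ge 1$ be integers, let $\Omega \subset \mathbb{R}^d$ be open and bounded, and let $p > 1$. Let $h : \mathbb{R}^m \to \mathbb{R}$ be a continuously differentiable, strictly convex function for which there is a constant $c > 0$ such that $$\frac{1}{c}|\lambda|^p - c \le h(\lambda) \le c|\lambda|^p + c \quad \text{for every } \lambda \in \mathbb{R}^m .$$ Let $u_n$ ($n \in \mathbb{N}$) and $u$ be functions $\Omega \to \mathbb{R}^m$ belonging to $L^p(\Omega)$. Then, as $n \to \infty$, $$\int_\Omega h(u_n | u)\, dx \to 0 \quad \text{if and only if} \quad u_n \to u \ \text{ in } L^p(\Omega).$$
   Context: For a continuously differentiable function $h : \mathbb{R}^m \to \mathbb{R}$, the relative entropy is defined for $v, u \in \mathbb{R}^m$ by $$h(v | u) = h(v) - h(u) - Dh(u) \cdot (v - u),$$ where $Dh$ is the gradient of $h$. For functions $v,u$ on $\Omega$, $h(v|u)$ denotes the function $x \mapsto h(v(x)|u(x))$. *)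

theory Defs
  imports "HOL-Analysis.Analysis"
begin

definition gradient :: "('a::real_inner \<Rightarrow> real) \<Rightarrow> 'a \<Rightarrow> 'a" where
  "gradient h u = (THE D. GDERIV h u :> D)"

lemma gradient_eqI:
  assumes "GDERIV h u :> D"
  shows "gradient h u = D"
  unfolding gradient_def
proof (rule the_equality)
  show "GDERIV h u :> D" by fact
next
  fix E assume "GDERIV h u :> E"
  with assms have "(\<lambda>v. inner v E) = (\<lambda>v. inner v D)"
    unfolding gderiv_def by (rule has_derivative_unique[rotated])
  then have "inner (E - D) E = inner (E - D) D" by metis
  then have "inner (E - D) (E - D) = 0" by (simp add: inner_diff_right)
  then show "E = D" by simp
qed

lemma GDERIV_gradient:
  fixes h :: "'a::euclidean_space \<Rightarrow> real"
  assumes "h differentiable (at u)"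
  shows "GDERIV h u :> gradient h u"
proof -
  from assms obtain h' where h': "(h has_derivative h') (at u)"
    by (auto simp: differentiable_def)
  then have lin: "linear h'" by (rule has_derivative_linear)
  define D where "D = (\<Sum>b\<in>Basis. h' b *\<^sub>R b)"
  have "h' v = inner v D" for v
  proof -
    have "h' v = h' (\<Sum>b\<in>Basis. (inner v b) *\<^sub>R b)" by (simp add: euclidean_representation)
    also have "\<dots> = inner v D"
      by (simp add: linear_sum[OF lin] linear_scale[OF lin] D_def inner_sum_right mult.commute)
    finally show ?thesis .
  qed
  then have "h' = (\<lambda>v. inner v D)" by (rule ext)
  with h' have "GDERIV h u :> D" by (simp add: gderiv_def)
  then show ?thesis using gradient_eqI by metis
qed

definition continuously_differentiable :: "('a::euclidean_space \<Rightarrow> real) \<Rightarrow> bool" where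
  "continuously_differentiable h \<longleftrightarrow>
     (\<forall>u. h differentiable (at u)) \<and> continuous_on UNIV (gradient h)"

definition strictly_convex_on :: "'a::real_vector set \<Rightarrow> ('a \<Rightarrow> real) \<Rightarrow> bool" where
  "strictly_convex_on S f \<longleftrightarrow> convex S \<and>
     (\<forall>x\<in>S. \<forall>y\<in>S. \<forall>t. x \<noteq> y \<longrightarrow> 0 < t \<longrightarrow> t < 1 \<longrightarrow>
        f ((1 - t) *\<^sub>R x + t *\<^sub>R y) < (1 - t) * f x + t * f y)"

definition relative_entropy :: "('a::real_inner \<Rightarrow> real) \<Rightarrow> 'a \<Rightarrow> 'a \<Rightarrow> real" where
  "relative_entropy h v u = h v - h u - inner (gradient h u) (v - u)"

text \<open>
  Functions on \<open>\<Omega>\<close> are total functions whose values outside \<open>\<Omega>\<close> are irrelevant, and elements of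
  \<open>L\<^sup>p(\<Omega>)\<close> are represented by Lebesgue measurable functions rather than by almost-everywhere
  classes. The Bochner integral of a non-integrable function is \<open>0\<close>, so \<open>Lp_norm\<close> is meaningful
  only on \<open>Lp_space\<close>.
\<close>

definition Lp_space ::
    "real \<Rightarrow> 'a::euclidean_space set \<Rightarrow> ('a \<Rightarrow> 'b::euclidean_space) set" where
  "Lp_space p \<Omega> = {f. f \<in> borel_measurable (lebesgue_on \<Omega>) \<and>
     integrable (lebesgue_on \<Omega>) (\<lambda>x. norm (f x) powr p)}"

definition Lp_norm ::
    "real \<Rightarrow> 'a::euclidean_space set \<Rightarrow> ('a \<Rightarrow> 'b::euclidean_space) \<Rightarrow> real" where
  "Lp_norm p \<Omega> f = (LINT x|lebesgue_on \<Omega>. norm (f x) powr p) powr (1 / p)"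

definition tendsto_Lp ::
    "real \<Rightarrow> 'a::euclidean_space set \<Rightarrow> (nat \<Rightarrow> 'a \<Rightarrow> 'b::euclidean_space) \<Rightarrow> ('a \<Rightarrow> 'b) \<Rightarrow> bool" where
  "tendsto_Lp p \<Omega> f g \<longleftrightarrow> (\<lambda>n. Lp_norm p \<Omega> (\<lambda>x. f n x - g x)) \<longlonglongrightarrow> 0"

end

theory Submission
  imports Defs
begin

text \<open>
  Both implications are instances of one transfer principle: if \<open>0 \<le> k\<^sub>n \<le> C g\<^sub>n + F\<close> with
  \<open>F\<close> integrable and \<open>g\<^sub>n \<longrightarrow> 0\<close> in \<open>L\<^sup>1\<close>, and if \<open>k\<^sub>n(x) \<longrightarrow> 0\<close> along every subsequence along
  which \<open>g\<^sub>n(x) \<longrightarrow> 0\<close>, then \<open>\<integral> k\<^sub>n \<longrightarrow> 0\<close>. Here \<open>g\<^sub>n\<close> and \<open>k\<^sub>n\<close> are \<open>h(u\<^sub>n|u)\<close> and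
  \<open>|u\<^sub>n - u|\<^sup>p\<close> in either order, and \<open>F\<close> is a multiple of \<open>(1 + |u|)\<^sup>p\<close>. Convexity turns the
  growth of \<open>h\<close> into the gradient bound \<open>|Dh(u)| \<le> K (1 + |u|)\<^bsup>p-1\<^esup>\<close>, which yields the
  domination in both directions. Pointwise, continuity of \<open>h\<close> gives one implication, while strict
  convexity bounds \<open>h(\<cdot>|u)\<close> away from \<open>0\<close> outside every ball around \<open>u\<close>.
\<close>

section \<open>Convergence of integrals through almost everywhere convergent subsequences\<close>

text \<open>Convergence in \<open>L^1\<close> gives convergence almost everywhere only along a
  subsequence, so the argument is by contradiction: a subsequence of integrals of \<open>k\<close>
  staying at distance \<open>e\<close> from 0 is refined until \<open>g\<close> converges to 0
  almost everywhere, and there the integrals of \<open>k\<close> tend to 0 after all.\<close>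

lemma integral_tendsto_zero_transfer:
  fixes g k :: "nat \<Rightarrow> 'a \<Rightarrow> real"
  assumes g: "\<And>n. integrable M (g n)" and k: "\<And>n. integrable M (k n)" and F: "integrable M F"
    and g0: "\<And>n x. x \<in> space M \<Longrightarrow> 0 \<le> g n x" and k0: "\<And>n x. x \<in> space M \<Longrightarrow> 0 \<le> k n x"
    and bound: "\<And>n x. x \<in> space M \<Longrightarrow> k n x \<le> C * g n x + F x"
    and F0: "\<And>x. x \<in> space M \<Longrightarrow> 0 \<le> F x" and C: "0 \<le> C"
    and pointwise: "\<And>x r. x \<in> space M \<Longrightarrow> strict_mono (r :: nat \<Rightarrow> nat) \<Longrightarrow>
      (\<lambda>n. g (r n) x) \<longlonglongrightarrow> 0 \<Longrightarrow> (\<lambda>n. k (r n) x) \<longlonglongrightarrow> 0"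
    and lim: "(\<lambda>n. LINT x|M. g n x) \<longlonglongrightarrow> 0"
  shows "(\<lambda>n. LINT x|M. k n x) \<longlonglongrightarrow> 0"
proof (rule ccontr)
  assume "\<not> ?thesis"
  then obtain e where e: "e > 0" "\<And>N. \<exists>n\<ge>N. \<bar>LINT x|M. k n x\<bar> \<ge> e"
    by (force simp: LIMSEQ_def dist_real_def not_less)
  have "infinite {n. \<bar>LINT x|M. k n x\<bar> \<ge> e}"
    unfolding infinite_nat_iff_unbounded_le using e(2) by blast
  then obtain s :: "nat \<Rightarrow> nat" where s: "strict_mono s" "\<And>n. \<bar>LINT x|M. k (s n) x\<bar> \<ge> e"
    using infinite_enumerate by blast
  have "(\<lambda>n. LINT x|M. norm (g (s n) x)) = (\<lambda>n. LINT x|M. g (s n) x)"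
    by (rule ext, rule Bochner_Integration.integral_cong) (auto simp: g0)
  then have "(\<lambda>n. LINT x|M. norm (g (s n) x)) \<longlonglongrightarrow> 0"
    using LIMSEQ_subseq_LIMSEQ[OF lim s(1)] by (simp add: comp_def)
  then obtain r where r: "strict_mono r" "AE x in M. (\<lambda>n. g (s (r n)) x) \<longlonglongrightarrow> 0"
    using tendsto_L1_AE_subseq[of M "\<lambda>n. g (s n)"] g by blast
  define q where "q = s \<circ> r"
  have q: "strict_mono q" unfolding q_def using s(1) r(1) by (rule strict_mono_o)
  have AEq: "AE x in M. (\<lambda>n. g (q n) x) \<longlonglongrightarrow> 0" using r(2) by (simp add: q_def)
  \<comment> \<open>The bound \<open>C * g + F\<close> varies with \<open>n\<close>, so dominated
    convergence is not applied to \<open>k\<close> itself. The excess of \<open>k\<close> over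
    \<open>C * g\<close> is dominated by \<open>F\<close> alone, and the integral of
    \<open>C * g\<close> tends to 0 by assumption.\<close>
  let ?f = "\<lambda>n x. max 0 (k (q n) x - C * g (q n) x)"
  have fint: "integrable M (?f n)" for n
    using g k by (intro integrable_max) auto
  have f_lim: "(\<lambda>n. LINT x|M. ?f n x) \<longlonglongrightarrow> (LINT x|M. 0)"
  proof (rule integral_dominated_convergence[OF _ _ F])
    show "AE x in M. (\<lambda>n. ?f n x) \<longlonglongrightarrow> 0"
      using AEq AE_space
    proof eventually_elim
      case (elim x)
      have "(\<lambda>n. k (q n) x) \<longlonglongrightarrow> 0" using pointwise[OF elim(2) q elim(1)] .
      then have "(\<lambda>n. ?f n x) \<longlonglongrightarrow> max 0 (0 - C * 0)"
        by (intro tendsto_intros elim)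
      then show ?case by simp
    qed
    show "AE x in M. norm (?f n x) \<le> F x" for n
      using AE_space
    proof eventually_elim
      case (elim x)
      then show ?case using bound[of x "q n"] F0[of x] by simp
    qed
  qed (use fint in auto)
  have "(\<lambda>n. (LINT x|M. ?f n x) + C * (LINT x|M. g (q n) x)) \<longlonglongrightarrow> (LINT x|M. 0) + C * 0"
    using LIMSEQ_subseq_LIMSEQ[OF lim q] by (intro tendsto_intros f_lim) (simp add: comp_def)
  then have dom_lim: "(\<lambda>n. LINT x|M. ?f n x + C * g (q n) x) \<longlonglongrightarrow> 0"
    using fint g by simp
  have dom: "norm (LINT x|M. k (q n) x) \<le> (LINT x|M. ?f n x + C * g (q n) x)" for n
  proof -
    have "0 \<le> (LINT x|M. k (q n) x)" by (rule Bochner_Integration.integral_nonneg) (rule k0)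
    moreover have "(LINT x|M. k (q n) x) \<le> (LINT x|M. ?f n x + C * g (q n) x)"
      by (rule integral_mono) (use fint g k in auto)
    ultimately show ?thesis by simp
  qed
  have "(\<lambda>n. LINT x|M. k (q n) x) \<longlonglongrightarrow> 0"
    by (rule Lim_null_comparison[OF always_eventually[OF allI, OF dom] dom_lim])
  then obtain n where "\<bar>LINT x|M. k (q n) x\<bar> < e"
    using e(1) by (force simp: LIMSEQ_def dist_real_def)
  with s(2)[of "r n"] show False by (simp add: q_def)
qed

section \<open>Elementary inequalities and limits for real powers\<close>

lemma powr_add_le:
  fixes a b p :: real
  assumes "0 \<le> a" "0 \<le> b" "0 < p"
  shows "(a + b) powr p \<le> 2 powr p * (a powr p + b powr p)"
proof -
  have "(a + b) powr p \<le> (2 * max a b) powr p"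
    using assms by (intro powr_mono2) auto
  also have "\<dots> = 2 powr p * max a b powr p"
    using assms by (simp add: powr_mult)
  also have "\<dots> \<le> 2 powr p * (a powr p + b powr p)"
    by (intro mult_left_mono) (auto simp: max_def)
  finally show ?thesis .
qed

text \<open>Young's inequality with an arbitrarily small weight \<open>e\<close> on
  \<open>b powr p\<close>. Instead of optimal constants, the proof compares \<open>b\<close> with
  \<open>C * a\<close>: for smaller \<open>b\<close> the term \<open>C * a powr p\<close> suffices,
  and for larger \<open>b\<close> the choice \<open>C powr (p - 1) = 1 / e\<close> lets
  \<open>e * b powr p\<close> suffice.\<close>

lemma Young_powr_ex:
  fixes p e :: real
  assumes p: "1 < p" and e: "0 < e"
  obtains C where "0 \<le> C"
    "\<And>a b. 1 \<le> a \<Longrightarrow> 0 \<le> b \<Longrightarrow> a powr (p - 1) * b \<le> e * b powr p + C * a powr p"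
proof
  define C where "C = (1 / e) powr (1 / (p - 1))"
  show "0 \<le> C" by (simp add: C_def)
  have Cpos: "C > 0" using e by (simp add: C_def)
  have Ce: "C powr (p - 1) = 1 / e" using p e by (simp add: C_def powr_powr)
  fix a b :: real assume a: "1 \<le> a" and b: "0 \<le> b"
  show "a powr (p - 1) * b \<le> e * b powr p + C * a powr p"
  proof (cases "b \<le> C * a")
    case True
    have "a powr (p - 1) * b \<le> a powr (p - 1) * (C * a)"
      using True by (intro mult_left_mono) auto
    also have "\<dots> = C * a powr p"
      using a by (simp add: powr_diff)
    finally show ?thesis using e by (simp add: add_increasing)
  next
    case False
    then have bpos: "b > 0" using Cpos a by (smt (verit) mult_pos_pos)
    have "(C * a) powr (p - 1) \<le> b powr (p - 1)"
      using False p Cpos a by (intro powr_mono2) auto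
    then have "a powr (p - 1) \<le> e * b powr (p - 1)"
      using Cpos a e by (simp add: powr_mult Ce field_simps)
    then have "a powr (p - 1) * b \<le> e * b powr (p - 1) * b"
      using b by (intro mult_right_mono) auto
    also have "\<dots> = e * b powr p" using bpos by (simp add: powr_diff)
    finally show ?thesis using Cpos by (simp add: add_increasing2)
  qed
qed

lemma tendsto_powr_zero_iff:
  fixes f :: "nat \<Rightarrow> real"
  assumes "0 < q" "\<And>n. 0 \<le> f n"
  shows "(\<lambda>n. f n powr q) \<longlonglongrightarrow> 0 \<longleftrightarrow> f \<longlonglongrightarrow> 0"
proof
  assume "(\<lambda>n. f n powr q) \<longlonglongrightarrow> 0"
  then have "(\<lambda>n. (f n powr q) powr (1 / q)) \<longlonglongrightarrow> 0"
    by (rule tendsto_zero_powrI[OF _ tendsto_const]) (use assms in auto)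
  moreover have "(f n powr q) powr (1 / q) = f n" for n
    using assms(1) assms(2)[of n] by (simp add: powr_powr)
  ultimately show "f \<longlonglongrightarrow> 0" by simp
next
  assume "f \<longlonglongrightarrow> 0"
  then show "(\<lambda>n. f n powr q) \<longlonglongrightarrow> 0"
    using assms by (intro tendsto_zero_powrI[OF _ tendsto_const]) auto
qed

section \<open>Strict convexity and pointwise properties of the relative entropy\<close>

lemma strictly_convex_onD:
  assumes "strictly_convex_on S f" "x \<in> S" "y \<in> S" "x \<noteq> y" "0 < t" "t < 1"
  shows "f ((1 - t) *\<^sub>R x + t *\<^sub>R y) < (1 - t) * f x + t * f y"
  using assms unfolding strictly_convex_on_def by simp

lemma strictly_convex_imp_convex_on:
  assumes "strictly_convex_on S f"
  shows "convex_on S f"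
proof (rule convex_onI)
  fix t :: real and x y assume "0 < t" "t < 1" "x \<in> S" "y \<in> S"
  then show "f ((1 - t) *\<^sub>R x + t *\<^sub>R y) \<le> (1 - t) * f x + t * f y"
  proof (cases "x = y")
    case True
    then show ?thesis by (simp flip: scaleR_add_left distrib_right)
  next
    case False
    with \<open>0 < t\<close> \<open>t < 1\<close> \<open>x \<in> S\<close> \<open>y \<in> S\<close> show ?thesis
      by (intro less_imp_le strictly_convex_onD[OF assms])
  qed
qed (use assms in \<open>simp add: strictly_convex_on_def\<close>)

text \<open>Along the line through \<open>u\<close> and \<open>v\<close>, \<open>h\<close> is a
  convex function of one variable and lies above its tangent at 0; evaluation at parameter 1 gives
  the claim.\<close>

lemma relative_entropy_nonneg:
  fixes h :: "'a::euclidean_space \<Rightarrow> real"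
  assumes conv: "convex_on UNIV h" and diff: "h differentiable (at u)"
  shows "0 \<le> relative_entropy h v u"
proof -
  let ?f = "\<lambda>t. h (u + t *\<^sub>R (v - u))"
  have "(h has_derivative (\<lambda>w. inner w (gradient h u))) (at (u + 0 *\<^sub>R (v - u)))"
    using GDERIV_gradient[OF diff] by (simp add: gderiv_def)
  moreover have "((\<lambda>t. u + t *\<^sub>R (v - u)) has_derivative (\<lambda>t. t *\<^sub>R (v - u))) (at 0)"
    by (auto intro!: derivative_eq_intros)
  ultimately have "(?f has_derivative (\<lambda>t. inner (t *\<^sub>R (v - u)) (gradient h u))) (at 0)"
    using has_derivative_compose by fastforce
  then have D: "(?f has_field_derivative inner (gradient h u) (v - u)) (at 0)"
    by (simp add: has_field_derivative_def inner_commute mult.commute[of _ "inner _ _"])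
  have "convex_on UNIV ?f"
  proof (rule convex_onI)
    fix t x y :: real assume t: "0 < t" "t < 1"
    have "u + ((1 - t) *\<^sub>R x + t *\<^sub>R y) *\<^sub>R (v - u) =
        (1 - t) *\<^sub>R (u + x *\<^sub>R (v - u)) + t *\<^sub>R (u + y *\<^sub>R (v - u))"
      by (simp add: algebra_simps)
    then show "?f ((1 - t) *\<^sub>R x + t *\<^sub>R y) \<le> (1 - t) * ?f x + t * ?f y"
      using convex_onD[OF conv, of t] t by simp
  qed simp
  from convex_on_imp_above_tangent[OF this _ _ _ D, of 1] show ?thesis
    by (simp add: relative_entropy_def)
qed

lemma relative_entropy_self [simp]: "relative_entropy h u u = 0"
  by (simp add: relative_entropy_def)

text \<open>By strict convexity the relative entropy at the midpoint of \<open>u\<close> and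
  \<open>v\<close> is strictly less than half of that at \<open>v\<close>, and it is
  nonnegative.\<close>

lemma relative_entropy_pos:
  fixes h :: "'a::euclidean_space \<Rightarrow> real"
  assumes conv: "strictly_convex_on UNIV h" and diff: "h differentiable (at u)" and "v \<noteq> u"
  shows "0 < relative_entropy h v u"
proof -
  let ?m = "u + (1 / 2) *\<^sub>R (v - u)"
  have "h (u + t *\<^sub>R (v - u)) < (1 - t) * h u + t * h v" if "0 < t" "t < 1" for t
  proof -
    have "h ((1 - t) *\<^sub>R u + t *\<^sub>R v) < (1 - t) * h u + t * h v"
      by (rule strictly_convex_onD[OF conv]) (use assms(3) that in auto)
    moreover have "(1 - t) *\<^sub>R u + t *\<^sub>R v = u + t *\<^sub>R (v - u)"
      by (simp add: algebra_simps)
    ultimately show ?thesis by simp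
  qed
  from this[of "1 / 2"] have "h ?m < (1 - 1 / 2) * h u + (1 / 2) * h v" by simp
  moreover have "0 \<le> relative_entropy h ?m u"
    by (rule relative_entropy_nonneg[OF strictly_convex_imp_convex_on[OF conv] diff])
  ultimately show ?thesis
    by (simp add: relative_entropy_def)
qed

text \<open>Convexity even gives the factor \<open>t\<close> on the right. This carries lower bounds
  on a sphere around \<open>u\<close> to all points outside it.\<close>

lemma relative_entropy_radial_le:
  fixes h :: "'a::euclidean_space \<Rightarrow> real"
  assumes conv: "convex_on UNIV h" and diff: "h differentiable (at u)" and t: "0 \<le> t" "t \<le> 1"
  shows "relative_entropy h (u + t *\<^sub>R (v - u)) u \<le> relative_entropy h v u"
proof -
  have "h ((1 - t) *\<^sub>R u + t *\<^sub>R v) \<le> (1 - t) * h u + t * h v"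
    using convex_onD[OF conv t] by simp
  moreover have "(1 - t) *\<^sub>R u + t *\<^sub>R v = u + t *\<^sub>R (v - u)"
    by (simp add: algebra_simps)
  ultimately have "relative_entropy h (u + t *\<^sub>R (v - u)) u \<le> t * relative_entropy h v u"
    by (simp add: relative_entropy_def algebra_simps)
  also have "\<dots> \<le> relative_entropy h v u"
    using relative_entropy_nonneg[OF conv diff] t by (simp add: mult_left_le_one_le)
  finally show ?thesis .
qed

lemma continuous_on_relative_entropy:
  assumes "continuous_on UNIV h"
  shows "continuous_on S (\<lambda>v. relative_entropy h v u)"
  unfolding relative_entropy_def
  by (intro continuous_intros continuous_on_subset[OF assms]) auto

text \<open>On the compact sphere of radius \<open>e\<close> around \<open>u\<close> the relative
  entropy attains a positive minimum, which by radial monotonicity is a lower bound everywhere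
  outside the ball. Smaller values therefore force \<open>w n\<close> into the ball.\<close>

lemma tendsto_if_relative_entropy_tendsto_zero:
  fixes h :: "'a::euclidean_space \<Rightarrow> real" and w :: "nat \<Rightarrow> 'a"
  assumes conv: "strictly_convex_on UNIV h" and cont: "continuous_on UNIV h"
    and diff: "h differentiable (at u)"
    and lim: "(\<lambda>n. relative_entropy h (w n) u) \<longlonglongrightarrow> 0"
  shows "w \<longlonglongrightarrow> u"
proof (rule LIMSEQ_I)
  fix e :: real assume e: "0 < e"
  let ?S = "sphere u e"
  have "?S \<noteq> {}" using e by simp
  then obtain z where z: "z \<in> ?S"
      "\<And>y. y \<in> ?S \<Longrightarrow> relative_entropy h z u \<le> relative_entropy h y u"
    using continuous_attains_inf[OF compact_sphere _ continuous_on_relative_entropy[OF cont]] by metis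
  have "z \<noteq> u" using z(1) e by force
  then have zpos: "0 < relative_entropy h z u" by (rule relative_entropy_pos[OF conv diff])
  have far: "relative_entropy h z u \<le> relative_entropy h v u" if v: "e \<le> norm (v - u)" for v
  proof -
    have "0 < norm (v - u)" using e v by linarith
    then have "e / norm (v - u) \<le> 1" using v by (simp only: divide_le_eq_1_pos)
    \<comment> \<open>Radial projection of \<open>v\<close> onto the sphere; the factor is at most 1
      because \<open>v\<close> lies outside the open ball.\<close>
    moreover have "u + (e / norm (v - u)) *\<^sub>R (v - u) \<in> ?S"
      using e v by (auto simp: dist_norm)
    from z(2)[OF this] calculation show ?thesis
      using relative_entropy_radial_le[OF strictly_convex_imp_convex_on[OF conv] diff,
          of "e / norm (v - u)" v] e v by simp
  qed
  obtain N where "\<And>n. n \<ge> N \<Longrightarrow> relative_entropy h (w n) u < relative_entropy h z u"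
    using order_tendstoD(2)[OF lim zpos] unfolding eventually_sequentially by auto
  then show "\<exists>N. \<forall>n\<ge>N. norm (w n - u) < e"
    using far by (meson not_le)
qed

section \<open>Growth of the gradient and two-sided comparison of \<open>h(v|u)\<close> with
  \<open>|v - u|^p\<close>\<close>

text \<open>The tangent inequality is tested at a point displaced from \<open>u\<close> in the
  direction of the gradient by the length \<open>s = 1 + norm u\<close>. The increment of
  \<open>h\<close> is then of order \<open>s powr p\<close>, and division by \<open>s\<close> leaves
  the exponent \<open>p - 1\<close>.\<close>

lemma gradient_growth:
  fixes h :: "'a::euclidean_space \<Rightarrow> real"
  assumes conv: "convex_on UNIV h" and diff: "\<And>u. h differentiable (at u)"
    and p: "0 \<le> p" and c: "0 \<le> c"
    and lower: "\<And>l. - c \<le> h l" and upper: "\<And>l. h l \<le> c * norm l powr p + c"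
  shows "norm (gradient h u) \<le> (c * 2 powr p + 2 * c) * (1 + norm u) powr (p - 1)"
proof -
  define s where "s = 1 + norm u"
  have s: "s \<ge> 1" by (simp add: s_def)
  let ?D = "gradient h u"
  \<comment> \<open>Since \<open>sgn 0 = 0\<close>, a vanishing gradient gives
    \<open>?w = 0\<close>, and the identity \<open>iw\<close> still holds.\<close>
  let ?w = "s *\<^sub>R sgn ?D"
  have nw: "norm ?w \<le> s" using s by (simp add: norm_sgn)
  have iw: "inner ?D ?w = s * norm ?D"
    by (cases "?D = 0") (simp_all add: sgn_div_norm power2_norm_eq_inner[symmetric] power2_eq_square)
  have "0 \<le> relative_entropy h (u + ?w) u" by (rule relative_entropy_nonneg[OF conv diff])
  then have "s * norm ?D \<le> h (u + ?w) - h u" unfolding relative_entropy_def add_diff_cancel_left' iw by linarith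
  also have "\<dots> \<le> c * norm (u + ?w) powr p + 2 * c" using upper[of "u + ?w"] lower[of u] by simp
  \<comment> \<open>Using \<open>1 + norm u\<close> rather than \<open>norm u\<close> ensures
    \<open>1 <= s powr p\<close>, so additive constants can be absorbed.\<close>
  also have "\<dots> \<le> c * (2 * s) powr p + 2 * c * s powr p"
  proof (intro add_mono mult_left_mono powr_mono2)
    show "norm (u + ?w) \<le> 2 * s" using norm_triangle_ineq[of u ?w] nw by (simp add: s_def)
    show "2 * c \<le> 2 * c * s powr p"
      using c s p by (simp add: mult_le_cancel_left1 ge_one_powr_ge_zero)
  qed (use c p in auto)
  also have "\<dots> = s * ((c * 2 powr p + 2 * c) * s powr (p - 1))"
    using s by (simp add: powr_mult powr_diff field_simps)
  finally show ?thesis using s unfolding s_def[symmetric] by simp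
qed

locale convex_growth =
  fixes h :: "'a::euclidean_space \<Rightarrow> real" and p c :: real
  assumes C1: "continuously_differentiable h"
    and strict: "strictly_convex_on UNIV h"
    and p: "1 < p" and c: "0 < c"
    and lower: "\<And>l. 1 / c * norm l powr p - c \<le> h l"
    and upper: "\<And>l. h l \<le> c * norm l powr p + c"
begin

lemma diff: "h differentiable (at u)"
  using C1 by (simp add: continuously_differentiable_def)

lemma conv: "convex_on UNIV h"
  using strict by (rule strictly_convex_imp_convex_on)

lemma cont: "continuous_on UNIV h"
  by (simp add: continuous_at_imp_continuous_on differentiable_imp_continuous_within diff)

lemma lower_const: "- c \<le> h l"
proof -
  have "0 \<le> 1 / c * norm l powr p" using c by simp
  with lower[of l] show ?thesis by linarith
qed

definition K :: real where "K = c * 2 powr p + 2 * c"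

lemma K_pos: "0 < K"
  using c by (simp add: K_def add_pos_pos)

lemma gradient_bound: "norm (gradient h u) \<le> K * (1 + norm u) powr (p - 1)"
  unfolding K_def using gradient_growth[OF conv diff _ _ lower_const upper] p c by simp

lemma inner_gradient_bound:
  "\<bar>inner (gradient h u) (v - u)\<bar> \<le> K * ((1 + norm u) powr (p - 1) * norm (v - u))"
proof -
  have "\<bar>inner (gradient h u) (v - u)\<bar> \<le> norm (gradient h u) * norm (v - u)"
    by (rule Cauchy_Schwarz_ineq2)
  also have "\<dots> \<le> K * (1 + norm u) powr (p - 1) * norm (v - u)"
    by (intro mult_right_mono gradient_bound) auto
  finally show ?thesis by (simp add: mult.assoc)
qed

lemma one_le_powr: "1 \<le> (1 + norm (u::'a)) powr p"
  using p by (simp add: ge_one_powr_ge_zero)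

lemma norm_le_powr: "norm (u::'a) powr p \<le> (1 + norm u) powr p"
  using p by (intro powr_mono2) auto

text \<open>The growth bound controls \<open>h v\<close> through
  \<open>norm v <= norm (v - u) + norm u\<close>, and Young's inequality splits the gradient term.
  The coefficient of \<open>norm (v - u) powr p\<close> may be large, so weight 1 is good
  enough.\<close>

lemma relative_entropy_upper:
  obtains C where "0 \<le> C"
    "\<And>u v. relative_entropy h v u \<le> C * norm (v - u) powr p + C * (1 + norm u) powr p"
proof -
  obtain Y where Y: "0 \<le> Y" "\<And>a b. 1 \<le> a \<Longrightarrow> 0 \<le> b \<Longrightarrow>
      a powr (p - 1) * b \<le> 1 * b powr p + Y * a powr p"
    using Young_powr_ex[OF p zero_less_one] by metis
  define A where "A = c * 2 powr p"
  have A: "0 \<le> A" using c by (simp add: A_def)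
  show ?thesis
  proof
    show "0 \<le> A + 2 * c + K + K * Y" using A c K_pos Y(1) by simp
    fix u v :: 'a
    let ?S = "(1 + norm u) powr p" and ?T = "norm (v - u) powr p"
    have "norm v powr p \<le> (norm (v - u) + norm u) powr p"
      using p norm_triangle_sub[of v u] by (intro powr_mono2) (auto simp: add.commute)
    also have "\<dots> \<le> 2 powr p * (?T + norm u powr p)"
      using p by (intro powr_add_le) auto
    also have "\<dots> \<le> 2 powr p * (?T + ?S)"
      using norm_le_powr by (intro mult_left_mono) auto
    finally have "c * norm v powr p \<le> c * (2 powr p * (?T + ?S))"
      using c by (intro mult_left_mono) auto
    then have "h v \<le> A * ?T + A * ?S + c"
      using upper[of v] by (simp add: A_def algebra_simps)
    moreover have "- inner (gradient h u) (v - u) \<le> K * (?T + Y * ?S)"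
    proof -
      have "K * ((1 + norm u) powr (p - 1) * norm (v - u)) \<le> K * (?T + Y * ?S)"
        using Y(2)[of "1 + norm u" "norm (v - u)"] K_pos by (intro mult_left_mono) auto
      then show ?thesis using inner_gradient_bound[of u v] by linarith
    qed
    moreover have "2 * c \<le> 2 * c * ?S" using c one_le_powr[of u] by simp
    \<comment> \<open>These surplus terms raise both coefficients to the same constant.\<close>
    moreover have "0 \<le> 2 * c * ?T" "0 \<le> K * Y * ?T" "0 \<le> K * ?S"
      using c K_pos Y(1) by auto
    ultimately show "relative_entropy h v u \<le>
        (A + 2 * c + K + K * Y) * ?T + (A + 2 * c + K + K * Y) * ?S"
      using lower_const[of u] by (simp add: relative_entropy_def algebra_simps)
  qed
qed

text \<open>The lower growth bound controls \<open>norm v powr p\<close> by the relative entropy,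
  \<open>h u\<close> and the gradient term. The last contributes a multiple of
  \<open>norm (v - u) powr p\<close>, which Young's inequality makes small enough to absorb on the
  left.\<close>

lemma norm_diff_powr_upper:
  obtains C where "0 \<le> C"
    "\<And>u v. norm (v - u) powr p \<le> C * relative_entropy h v u + C * (1 + norm u) powr p"
proof -
  \<comment> \<open>Multiplication by \<open>B\<close> turns \<open>1 / c * norm v powr p\<close>
    into the \<open>2 powr p * norm v powr p\<close> that \<open>powr_add_le\<close> produces. The
    weight \<open>e\<close> is then fixed by \<open>B * K * e = 1 / 2\<close>, so that exactly half
    of \<open>?T\<close> is to be absorbed.\<close>
  define B where "B = 2 powr p * c"
  have B: "0 < B" using c by (simp add: B_def)
  define e where "e = 1 / (2 * B * K)"
  have e: "0 < e" "B * K * e = 1 / 2" using B K_pos by (simp_all add: e_def)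
  obtain Y where Y: "0 \<le> Y" "\<And>a b. 1 \<le> a \<Longrightarrow> 0 \<le> b \<Longrightarrow>
      a powr (p - 1) * b \<le> e * b powr p + Y * a powr p"
    using Young_powr_ex[OF p e(1)] by metis
  define C where "C = 2 * (B + B * (3 * c + K * Y) + 2 powr p)"
  have Cge: "2 * B \<le> C" "2 * (B * (3 * c + K * Y) + 2 powr p) \<le> C"
    using B c K_pos Y(1) by (auto simp: C_def)
  show ?thesis
  proof
    show "0 \<le> C" using Cge(1) B by simp
    fix u v :: 'a
    let ?S = "(1 + norm u) powr p" and ?T = "norm (v - u) powr p" and ?R = "relative_entropy h v u"
    have "1 / c * norm v powr p \<le> ?R + h u + inner (gradient h u) (v - u) + c"
      using lower[of v] by (simp add: relative_entropy_def)
    moreover have "h u \<le> c * ?S + c"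
      using upper[of u] mult_left_mono[OF norm_le_powr[of u], of c] c by linarith
    moreover have "inner (gradient h u) (v - u) \<le> K * (e * ?T + Y * ?S)"
    proof -
      have "K * ((1 + norm u) powr (p - 1) * norm (v - u)) \<le> K * (e * ?T + Y * ?S)"
        using Y(2)[of "1 + norm u" "norm (v - u)"] K_pos by (intro mult_left_mono) auto
      then show ?thesis using inner_gradient_bound[of u v] by linarith
    qed
    moreover have "?R + (c * ?S + c) + K * (e * ?T + Y * ?S) + c \<le>
        ?R + K * e * ?T + (3 * c + K * Y) * ?S"
      using mult_left_mono[OF one_le_powr[of u], of "2 * c"] c by (simp add: algebra_simps)
    ultimately have "1 / c * norm v powr p \<le> ?R + K * e * ?T + (3 * c + K * Y) * ?S"
      by linarith
    then have Bv: "B * (1 / c * norm v powr p) \<le> B * (?R + K * e * ?T + (3 * c + K * Y) * ?S)"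
      by (rule mult_left_mono) (use B in simp)
    have v: "2 powr p * norm v powr p \<le> B * ?R + ?T / 2 + B * (3 * c + K * Y) * ?S"
    proof -
      have "B * (1 / c * norm v powr p) = 2 powr p * norm v powr p" using c by (simp add: B_def)
      moreover have "B * (?R + K * e * ?T + (3 * c + K * Y) * ?S) =
          B * ?R + (B * K * e) * ?T + B * (3 * c + K * Y) * ?S"
        by (simp add: algebra_simps)
      ultimately show ?thesis using Bv unfolding e(2) by simp
    qed
    have "?T \<le> (norm v + norm u) powr p"
      using p norm_triangle_ineq4[of v u] by (intro powr_mono2) auto
    also have "\<dots> \<le> 2 powr p * (norm v powr p + norm u powr p)"
      using p by (intro powr_add_le) auto
    also have "\<dots> \<le> 2 powr p * (norm v powr p + ?S)"
      using norm_le_powr by (intro mult_left_mono) auto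
    \<comment> \<open>Moving \<open>?T / 2\<close> to the left doubles the remaining coefficients.
      Nonnegativity of \<open>?R\<close> then allows its coefficient to be enlarged to
      \<open>C\<close>.\<close>
    finally have "?T \<le> 2 * B * ?R + 2 * (B * (3 * c + K * Y) + 2 powr p) * ?S"
      using v by (simp add: algebra_simps)
    also have "\<dots> \<le> C * ?R + C * ?S"
      using Cge relative_entropy_nonneg[OF conv diff]
      by (intro add_mono mult_right_mono) auto
    finally show "?T \<le> C * ?R + C * ?S" .
  qed
qed

end

section \<open>Integrability on the domain and the equivalence\<close>

text \<open>Serves both \<open>u_seq n - u\<close> and \<open>1 + norm u\<close>; the separate
  codomains of \<open>f\<close> and \<open>g\<close> let the real constant 1 be paired with the
  vector-valued \<open>u\<close>.\<close>

lemma integrable_norm_add_powr: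
  fixes f :: "'a \<Rightarrow> 'b::euclidean_space" and g :: "'a \<Rightarrow> 'c::euclidean_space"
  assumes p: "0 < p" and meas: "k \<in> borel_measurable M"
    and f: "integrable M (\<lambda>x. norm (f x) powr p)" and g: "integrable M (\<lambda>x. norm (g x) powr p)"
    and le: "\<And>x. x \<in> space M \<Longrightarrow> \<bar>k x\<bar> \<le> norm (f x) + norm (g x)"
  shows "integrable M (\<lambda>x. \<bar>k x\<bar> powr p)"
proof (rule Bochner_Integration.integrable_bound)
  show "integrable M (\<lambda>x. 2 powr p * (norm (f x) powr p + norm (g x) powr p))"
    using f g by auto
  show "AE x in M. norm (\<bar>k x\<bar> powr p) \<le> norm (2 powr p * (norm (f x) powr p + norm (g x) powr p))"
    using AE_space
  proof eventually_elim
    case (elim x)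
    have "\<bar>k x\<bar> powr p \<le> (norm (f x) + norm (g x)) powr p"
      using le[OF elim] p by (intro powr_mono2) auto
    also have "\<dots> \<le> 2 powr p * (norm (f x) powr p + norm (g x) powr p)"
      using p by (intro powr_add_le) auto
    finally show ?case by simp
  qed
qed (use meas in measurable)

theorem theorem2p2:
  fixes \<Omega> :: "(real ^ 'd) set"
    and p :: real
    and h :: "real ^ 'm \<Rightarrow> real"
    and u :: "real ^ 'd \<Rightarrow> real ^ 'm"
    and u_seq :: "nat \<Rightarrow> real ^ 'd \<Rightarrow> real ^ 'm"
  assumes "open \<Omega>" and "bounded \<Omega>"
    and "p > 1"
    and "continuously_differentiable h"
    and "strictly_convex_on UNIV h"
    and "\<exists>c>0. \<forall>l. 1 / c * norm l powr p - c \<le> h l \<and> h l \<le> c * norm l powr p + c"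
    and "\<And>n. u_seq n \<in> Lp_space p \<Omega>"
    and "u \<in> Lp_space p \<Omega>"
  shows "(\<lambda>n. LINT x|lebesgue_on \<Omega>. relative_entropy h (u_seq n x) (u x)) \<longlonglongrightarrow> 0
    \<longleftrightarrow> tendsto_Lp p \<Omega> u_seq u"
proof -
  obtain c where c: "c > 0" "\<forall>l. 1 / c * norm l powr p - c \<le> h l \<and> h l \<le> c * norm l powr p + c"
    using assms(6) by blast
  interpret convex_growth h p c
    by unfold_locales (use assms c in auto)
  let ?M = "lebesgue_on \<Omega>"
  let ?R = "\<lambda>n x. relative_entropy h (u_seq n x) (u x)"
  let ?T = "\<lambda>n x. norm (u_seq n x - u x) powr p"
  let ?S = "\<lambda>x. (1 + norm (u x)) powr p"
  have [measurable]: "u_seq n \<in> borel_measurable ?M" "u \<in> borel_measurable ?M" for n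
    using assms(7,8) by (auto simp: Lp_space_def)
  have int: "integrable ?M (\<lambda>x. norm (u_seq n x) powr p)" "integrable ?M (\<lambda>x. norm (u x) powr p)" for n
    using assms(7,8) by (auto simp: Lp_space_def)
  have [measurable]: "h \<in> borel_measurable borel"
    using cont by (rule borel_measurable_continuous_onI)
  have [measurable]: "gradient h \<in> borel_measurable borel"
    using assms(4) unfolding continuously_differentiable_def
    by (intro borel_measurable_continuous_onI) simp
  have R_meas: "?R n \<in> borel_measurable ?M" for n
    unfolding relative_entropy_def by measurable
  \<comment> \<open>Finite measure of the domain makes constants integrable, hence also
    \<open>?S\<close>.\<close>
  have "\<Omega> \<in> lmeasurable"
    using assms(1,2) by (rule lmeasurable_open[rotated])
  then have "finite_measure ?M"
    by (rule finite_measure_lebesgue_on)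
  then have one: "integrable ?M (\<lambda>x. norm (1::real) powr p)"
    by (simp add: finite_measure.integrable_const)
  have T_int: "integrable ?M (?T n)" for n
    using integrable_norm_add_powr[of p "\<lambda>x. norm (u_seq n x - u x)", OF _ _ int(1)[of n] int(2)] p
    by (simp add: norm_triangle_ineq4)
  have S_int: "integrable ?M ?S"
    using integrable_norm_add_powr[of p "\<lambda>x. 1 + norm (u x)", OF _ _ one int(2)] p by simp
  have R0: "0 \<le> ?R n x" for n x by (rule relative_entropy_nonneg[OF conv diff])
  obtain C where C: "0 \<le> C" "\<And>w v. relative_entropy h v w \<le> C * norm (v - w) powr p + C * (1 + norm w) powr p"
    using relative_entropy_upper by blast
  obtain C' where C': "0 \<le> C'" "\<And>w v. norm (v - w) powr p \<le> C' * relative_entropy h v w + C' * (1 + norm w) powr p"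
    using norm_diff_powr_upper by blast
  \<comment> \<open>This makes the entropy integrals genuine: a non-integrable function would
    receive the default value 0.\<close>
  have R_int: "integrable ?M (?R n)" for n
  proof (rule Bochner_Integration.integrable_bound[OF _ R_meas])
    show "integrable ?M (\<lambda>x. C * ?T n x + C * ?S x)" using T_int S_int by simp
    show "AE x in ?M. norm (?R n x) \<le> norm (C * ?T n x + C * ?S x)"
      using order_trans[OF C(2) abs_ge_self] R0[of n] by (intro AE_I2) simp
  qed
  \<comment> \<open>The outer exponent \<open>1 / p\<close> of the norm does not affect convergence
    to 0.\<close>
  have "tendsto_Lp p \<Omega> u_seq u \<longleftrightarrow> (\<lambda>n. LINT x|?M. ?T n x) \<longlonglongrightarrow> 0"
    unfolding tendsto_Lp_def Lp_norm_def using p by (intro tendsto_powr_zero_iff) auto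
  moreover have "(\<lambda>n. LINT x|?M. ?T n x) \<longlonglongrightarrow> 0" if "(\<lambda>n. LINT x|?M. ?R n x) \<longlonglongrightarrow> 0"
  proof (rule integral_tendsto_zero_transfer[OF R_int T_int _ R0 _ C'(2) _ C'(1) _ that])
    fix x and r :: "nat \<Rightarrow> nat" assume "(\<lambda>n. ?R (r n) x) \<longlonglongrightarrow> 0"
    then have "(\<lambda>n. u_seq (r n) x) \<longlonglongrightarrow> u x"
      by (rule tendsto_if_relative_entropy_tendsto_zero[OF strict cont diff])
    then show "(\<lambda>n. ?T (r n) x) \<longlonglongrightarrow> 0"
      using p by (subst tendsto_powr_zero_iff) (auto simp: tendsto_norm_zero_iff LIM_zero)
  qed (use S_int C'(1) in auto)
  moreover have "(\<lambda>n. LINT x|?M. ?R n x) \<longlonglongrightarrow> 0" if "(\<lambda>n. LINT x|?M. ?T n x) \<longlonglongrightarrow> 0"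
  proof (rule integral_tendsto_zero_transfer[OF T_int R_int _ _ R0 C(2) _ C(1) _ that])
    fix x and r :: "nat \<Rightarrow> nat" assume "(\<lambda>n. ?T (r n) x) \<longlonglongrightarrow> 0"
    then have "(\<lambda>n. u_seq (r n) x) \<longlonglongrightarrow> u x"
      using p by (subst (asm) tendsto_powr_zero_iff) (auto simp: tendsto_norm_zero_iff LIM_zero_iff)
    then have "(\<lambda>n. ?R (r n) x) \<longlonglongrightarrow> relative_entropy h (u x) (u x)"
      by (rule continuous_on_tendsto_compose[OF continuous_on_relative_entropy[OF cont, of UNIV]]) auto
    then show "(\<lambda>n. ?R (r n) x) \<longlonglongrightarrow> 0" by simp
  qed (use S_int C(1) in auto)
  ultimately show ?thesis by blast
qed

end
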